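(* Let $X$ and $Y$ be metric spaces and let $\Psi:X\rightrightarrows Y$ be a set-valued mapping. If $\Psi$ is set-covering on $X$ with constant $\alpha>0$, then $\Psi^{-\sharp}:\mathcal{B}(Y)\rightrightarrows X$ is Lipschitz with constant $1/\alpha$. Conversely, given $\Psi:X\to\mathcal{B}(Y)$ (i.e. a set-valued mapping with bounded values), if $\Psi^{-\sharp}:\mathcal{B}(Y)\rightrightarrows X$ is Lipschitz with constant $l$, $0<l<+\infty$, then $\Psi$ is set-covering on $X$ with any constant $\alpha\in(0,1/l)$.
   Context: Conventions: $\Psi$ is assumed to have nonempty closed values at every point of $X$. In a metric space, $\mathrm{B}(x,r)$ is the closed ball of center $x$ and radius $r$; $\operatorname{dist}(x,S)=\inf_{z\in S}d(z,x)$, with $\operatorname{dist}(x,\varnothing)=+\infty$; $\mathrm{B}(S,r)=\{x:\operatorname{dist}(x,S)\le r\}$; $\operatorname{exc}(A,B)=\sup_{a\in A}\operatorname{dist}(a,B)\in[0,+\infty]$ (with $\operatorname{exc}(\varnothing,B)=0$); the Hausdorff distance is $\operatorname{Haus}(A,B)=\max\{\operatorname{exc}(A,B),\operatorname{exc}(B,A)\}$. $\Psi$ is set-covering on $X$ with constant $\alpha>0$ if for every $x\in X$ and every $r>0$ there exists $u\in \mathrm{B}(x,r)$ such that $\mathrm{B}(\Psi(x),\alpha r)\subseteq\Psi(u)$. $\mathcal{B}(Y)$ is the collection of all bounded subsets of $Y$, equipped with the Hausdorff distance. $\Psi^{-\sharp}(S)=\{x\in X: S\subseteq\Psi(x)\}$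 for $S\in\mathcal{B}(Y)$ (possibly empty). That $\Psi^{-\sharp}$ is Lipschitz with constant $l$ means $\operatorname{exc}(\Psi^{-\sharp}(A),\Psi^{-\sharp}(B))\le l\operatorname{Haus}(A,B)$ for all $A,B\in\mathcal{B}(Y)$ (equivalently, by symmetry, $\operatorname{Haus}(\Psi^{-\sharp}(A),\Psi^{-\sharp}(B))\le l\operatorname{Haus}(A,B)$). *)

theory Defs
  imports "HOL-Analysis.Analysis"
begin

text \<open>
  Set-valued mappings from \<open>X\<close> to \<open>Y\<close> are functions into \<open>Y set\<close>.  Distances to sets are taken
  in \<^typ>\<open>ennreal\<close>, since the library's \<^const>\<open>infdist\<close> is real-valued and returns \<open>0\<close> for the
  empty set, whereas here the distance to the empty set is infinite (\<open>INF\<close> over the empty set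
  is \<open>top\<close>).
\<close>

definition pdist :: "'a::metric_space \<Rightarrow> 'a set \<Rightarrow> ennreal" where
  "pdist x S = (INF z\<in>S. ennreal (dist z x))"

definition enlargement :: "'a::metric_space set \<Rightarrow> real \<Rightarrow> 'a set" where
  "enlargement S r = {x. pdist x S \<le> ennreal r}"

text \<open>In \<^typ>\<open>ennreal\<close>, \<open>SUP\<close> over the empty set is \<open>0\<close>.\<close>

definition exc :: "'a::metric_space set \<Rightarrow> 'a set \<Rightarrow> ennreal" where
  "exc A B = (SUP a\<in>A. pdist a B)"

definition Haus :: "'a::metric_space set \<Rightarrow> 'a set \<Rightarrow> ennreal" where
  "Haus A B = max (exc A B) (exc B A)"

definition set_covering :: "('a::metric_space \<Rightarrow> 'b::metric_space set) \<Rightarrow> real \<Rightarrow> bool" where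
  "set_covering \<Psi> \<alpha> \<longleftrightarrow>
    (\<forall>x. \<forall>r>0. \<exists>u\<in>cball x r. enlargement (\<Psi> x) (\<alpha> * r) \<subseteq> \<Psi> u)"

definition inv_sharp :: "('a \<Rightarrow> 'b set) \<Rightarrow> 'b set \<Rightarrow> 'a set" where
  "inv_sharp \<Psi> S = {x. S \<subseteq> \<Psi> x}"

text \<open>
  Lipschitz continuity of a set-valued mapping defined on the bounded subsets of \<open>Y\<close> (the empty
  set included), equipped with the Hausdorff distance; only its values at bounded sets matter.
\<close>

definition lipschitz_on_bounded_sets ::
    "('b::metric_space set \<Rightarrow> 'a::metric_space set) \<Rightarrow> real \<Rightarrow> bool" where
  "lipschitz_on_bounded_sets F l \<longleftrightarrow>
    (\<forall>A B. bounded A \<longrightarrow> bounded B \<longrightarrow> exc (F A) (F B) \<le> ennreal l * Haus A B)"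

end

theory Submission
  imports Defs
begin

text \<open>
  Both directions rest on the observation that, for real \<open>r\<close>, \<open>exc B A \<le> r\<close> says exactly that \<open>B\<close>
  lies in the closed \<open>r\<close>-enlargement of \<open>A\<close>.

  If \<open>\<Psi>\<close> is set-covering with constant \<open>\<alpha>\<close> and \<open>A \<subseteq> \<Psi> x\<close>, then for every real \<open>r > 0\<close> with
  \<open>exc B A \<le> \<alpha> r\<close> the set \<open>B\<close> lies in the \<open>\<alpha> r\<close>-enlargement of \<open>\<Psi> x\<close>, and the covering property
  yields a point \<open>u\<close> within \<open>r\<close> of \<open>x\<close> with \<open>B \<subseteq> \<Psi> u\<close>. Letting \<open>r\<close> decrease to
  \<open>exc B A / \<alpha>\<close> gives the Lipschitz estimate, which is trivial when the excess is infinite.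

  Conversely, the Lipschitz estimate is applied to the bounded set \<open>\<Psi> x\<close> and its
  \<open>\<alpha> r\<close>-enlargement, which are at Hausdorff distance at most \<open>\<alpha> r\<close>. The distance from \<open>x\<close> to the
  points \<open>u\<close> whose value contains the enlargement is therefore at most \<open>l \<alpha> r\<close>. Since
  \<open>l \<alpha> < 1\<close>, this is strictly less than \<open>r\<close>, so such a point exists in the ball of radius \<open>r\<close> even
  though the infimum defining the distance need not be attained.
\<close>

lemma pdist_antimono: "S \<subseteq> T \<Longrightarrow> pdist x T \<le> pdist x S"
  unfolding pdist_def by (rule INF_superset_mono) auto

lemma pdist_le_dist: "z \<in> S \<Longrightarrow> pdist x S \<le> ennreal (dist z x)"
  unfolding pdist_def by (rule INF_lower)

lemma pdist_lessD:
  assumes "pdist x S < ennreal r"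
  shows "\<exists>z\<in>S. dist z x < r"
  using assms unfolding pdist_def INF_less_iff by (auto simp: ennreal_less_iff)

lemma exc_le_iff_subset_enlargement: "exc B A \<le> ennreal r \<longleftrightarrow> B \<subseteq> enlargement A r"
  unfolding exc_def enlargement_def by (auto simp: SUP_le_iff)

lemma enlargement_mono: "S \<subseteq> T \<Longrightarrow> enlargement S r \<subseteq> enlargement T r"
  unfolding enlargement_def by (auto intro: order_trans[OF pdist_antimono])

lemma subset_enlargement: "S \<subseteq> enlargement S r"
  unfolding enlargement_def by (auto intro: order_trans[OF pdist_le_dist])

lemma bounded_enlargement:
  assumes "bounded S" and "r \<ge> 0"
  shows "bounded (enlargement S r)"
proof -
  obtain a e where e: "\<And>z. z \<in> S \<Longrightarrow> dist a z \<le> e"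
    using assms(1) unfolding bounded_def by blast
  have "dist a y \<le> e + (r + 1)" if "y \<in> enlargement S r" for y
  proof -
    have "pdist y S \<le> ennreal r"
      using that by (simp add: enlargement_def)
    also have "\<dots> < ennreal (r + 1)"
      using assms(2) by (simp add: ennreal_less_iff)
    finally obtain z where "z \<in> S" "dist z y < r + 1"
      using pdist_lessD by blast
    then show ?thesis
      using e[of z] dist_triangle[of a y z] by linarith
  qed
  then show ?thesis
    unfolding bounded_def by blast
qed

lemma Haus_enlargement_le: "Haus S (enlargement S r) \<le> ennreal r"
proof -
  have "exc S (enlargement S r) \<le> ennreal 0"
    unfolding exc_le_iff_subset_enlargement
    by (rule order_trans[OF subset_enlargement subset_enlargement])
  moreover have "exc (enlargement S r) S \<le> ennreal r"
    by (simp add: exc_le_iff_subset_enlargement)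
  ultimately show ?thesis
    by (simp add: Haus_def)
qed

text \<open>
  The one-sided excess of \<open>B\<close> over \<open>A\<close> already controls the excess of \<open>inv_sharp \<Psi> A\<close> over
  \<open>inv_sharp \<Psi> B\<close>, with the roles of the two sets exchanged because \<open>inv_sharp \<Psi>\<close> reverses
  inclusions.
\<close>

lemma set_covering_imp_exc_inv_sharp_le:
  assumes "set_covering \<Psi> \<alpha>" and "\<alpha> > 0"
  shows "exc (inv_sharp \<Psi> A) (inv_sharp \<Psi> B) \<le> ennreal (1 / \<alpha>) * exc B A"
proof (cases "exc B A")
  case (real h)
  have "pdist x (inv_sharp \<Psi> B) \<le> ennreal (h / \<alpha>)" if "A \<subseteq> \<Psi> x" for x
  proof (rule ennreal_le_epsilon)
    fix e :: real
    assume "e > 0"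
    \<comment> \<open>The covering property requires a positive radius, also when \<open>h = 0\<close>.\<close>
    define r where "r = h / \<alpha> + e"
    have "r > 0" and "h \<le> \<alpha> * r"
      using \<open>e > 0\<close> \<open>\<alpha> > 0\<close> \<open>h \<ge> 0\<close> by (auto simp: r_def add_nonneg_pos distrib_left)
    then obtain u where u: "u \<in> cball x r" "enlargement (\<Psi> x) (\<alpha> * r) \<subseteq> \<Psi> u"
      using assms(1) unfolding set_covering_def by blast
    have "B \<subseteq> enlargement A (\<alpha> * r)"
      using real \<open>h \<le> \<alpha> * r\<close>
      by (simp add: exc_le_iff_subset_enlargement[symmetric] ennreal_leI)
    also have "\<dots> \<subseteq> enlargement (\<Psi> x) (\<alpha> * r)"
      using that by (rule enlargement_mono)
    finally have "u \<in> inv_sharp \<Psi> B"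
      using u(2) by (auto simp: inv_sharp_def)
    then have "pdist x (inv_sharp \<Psi> B) \<le> ennreal (dist u x)"
      by (rule pdist_le_dist)
    also have "\<dots> \<le> ennreal r"
      using u(1) by (auto simp: dist_commute intro: ennreal_leI)
    also have "\<dots> = ennreal (h / \<alpha>) + ennreal e"
      using \<open>e > 0\<close> \<open>\<alpha> > 0\<close> \<open>h \<ge> 0\<close> by (simp add: r_def)
    finally show "pdist x (inv_sharp \<Psi> B) \<le> ennreal (h / \<alpha>) + ennreal e" .
  qed
  then have "exc (inv_sharp \<Psi> A) (inv_sharp \<Psi> B) \<le> ennreal (h / \<alpha>)"
    unfolding exc_def by (auto simp: SUP_le_iff inv_sharp_def)
  also have "\<dots> = ennreal (1 / \<alpha>) * exc B A"
    using real \<open>\<alpha> > 0\<close> by (simp add: ennreal_mult[symmetric])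
  finally show ?thesis .
next
  case top
  then show ?thesis
    using \<open>\<alpha> > 0\<close> by (simp add: ennreal_mult_top)
qed

lemma set_covering_imp_lipschitz_inv_sharp:
  assumes "set_covering \<Psi> \<alpha>" and "\<alpha> > 0"
  shows "lipschitz_on_bounded_sets (inv_sharp \<Psi>) (1 / \<alpha>)"
  unfolding lipschitz_on_bounded_sets_def Haus_def
  using set_covering_imp_exc_inv_sharp_le[OF assms]
  by (meson max.cobounded2 mult_left_mono order_trans zero_le)

lemma lipschitz_inv_sharp_imp_set_covering:
  assumes lip: "lipschitz_on_bounded_sets (inv_sharp \<Psi>) l"
    and bdd: "\<And>x. bounded (\<Psi> x)"
    and "l \<ge> 0" and "\<alpha> \<ge> 0" and "l * \<alpha> < 1"
  shows "set_covering \<Psi> \<alpha>"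
  unfolding set_covering_def
proof (intro allI impI)
  fix x and r :: real
  assume "r > 0"
  define B where "B = enlargement (\<Psi> x) (\<alpha> * r)"
  have "bounded B"
    unfolding B_def using bdd \<open>\<alpha> \<ge> 0\<close> \<open>r > 0\<close> by (intro bounded_enlargement) auto
  have "pdist x (inv_sharp \<Psi> B) \<le> exc (inv_sharp \<Psi> (\<Psi> x)) (inv_sharp \<Psi> B)"
    unfolding exc_def by (rule SUP_upper) (simp add: inv_sharp_def)
  also have "\<dots> \<le> ennreal l * Haus (\<Psi> x) B"
    using lip bdd \<open>bounded B\<close> unfolding lipschitz_on_bounded_sets_def by blast
  also have "\<dots> \<le> ennreal l * ennreal (\<alpha> * r)"
    unfolding B_def by (intro mult_left_mono Haus_enlargement_le) simp
  also have "\<dots> = ennreal (l * \<alpha> * r)"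
    using \<open>l \<ge> 0\<close> \<open>\<alpha> \<ge> 0\<close> \<open>r > 0\<close> by (simp add: ennreal_mult[symmetric] mult.assoc)
  also have "\<dots> < ennreal r"
    using \<open>l \<ge> 0\<close> \<open>\<alpha> \<ge> 0\<close> \<open>r > 0\<close> \<open>l * \<alpha> < 1\<close> by (simp add: ennreal_less_iff)
  finally obtain u where "u \<in> inv_sharp \<Psi> B" "dist u x < r"
    using pdist_lessD by blast
  then show "\<exists>u\<in>cball x r. enlargement (\<Psi> x) (\<alpha> * r) \<subseteq> \<Psi> u"
    by (intro bexI[of _ u]) (auto simp: inv_sharp_def B_def dist_commute)
qed

theorem proposition2p11:
  fixes \<Psi> :: "'a::metric_space \<Rightarrow> 'b::metric_space set"
  assumes "\<And>x. \<Psi> x \<noteq> {}"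
    and "\<And>x. closed (\<Psi> x)"
  shows "(\<forall>\<alpha>>0. set_covering \<Psi> \<alpha> \<longrightarrow> lipschitz_on_bounded_sets (inv_sharp \<Psi>) (1 / \<alpha>))
    \<and> ((\<forall>x. bounded (\<Psi> x)) \<longrightarrow>
        (\<forall>l>0. lipschitz_on_bounded_sets (inv_sharp \<Psi>) l \<longrightarrow>
          (\<forall>\<alpha>\<in>{0<..<1 / l}. set_covering \<Psi> \<alpha>)))"
proof (intro conjI allI impI ballI)
  fix \<alpha> :: real
  assume "\<alpha> > 0" "set_covering \<Psi> \<alpha>"
  then show "lipschitz_on_bounded_sets (inv_sharp \<Psi>) (1 / \<alpha>)"
    by (intro set_covering_imp_lipschitz_inv_sharp)
next
  fix l \<alpha> :: real
  assume "\<forall>x. bounded (\<Psi> x)" "l > 0" "lipschitz_on_bounded_sets (inv_sharp \<Psi>) l"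
    and "\<alpha> \<in> {0<..<1 / l}"
  then show "set_covering \<Psi> \<alpha>"
    by (intro lipschitz_inv_sharp_imp_set_covering[of \<Psi> l]) (auto simp: field_simps)
qed

end
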